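(* Let $(X,R,S,\{e\})$ be a finitely decomposable relational interchange monoid with single unit $e$ such that both relational monoids $(X,R,\{e\})$ and $(X,S,\{e\})$ are graded, and let $(K,+,\bullet,\diamond,0,1,{}^{\star_\bullet},{}^{\star_\diamond})$ be an interchange Kleene algebra. Then $K^X$, with pointwise addition, constant $0$, unit $\delta_e$ ($\delta_e(e)=1$, $\delta_e(x)=0$ for $x\ne e$), convolutions $(f\ast g)(x)=\sum\{f(y)\bullet g(z)\mid R^x_{yz}\}$ and $(f\circledast g)(x)=\sum\{f(y)\diamond g(z)\mid S^x_{yz}\}$, and stars $f^{\star_\ast}(e)=(f(e))^{\star_\bullet}$, $f^{\star_\ast}(x)=(f(e))^{\star_\bullet}\bullet\sum\{f(y)\bullet f^{\star_\ast}(z)\mid R^x_{yz},y\ne e\}$ for $x\ne e$, and analogously $f^{\star_\circledast}$ using $S$, $\diamond$ and ${}^{\star_\diamond}$, is an interchange Kleene algebra.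
   Context: $R^x_{yz}$ denotes that ternary relation $R$ holds at $(x,y,z)$. Relational associativity of $R$: for all $x,u,v,w$, $(\exists y.\ R^y_{uv}\wedge R^x_{yw})\Leftrightarrow(\exists y.\ R^x_{uy}\wedge R^y_{vw})$. $\{e\}$ is a set of relational units for $R$ if for all $x,y$: $R^x_{ex}$, $R^x_{xe}$, and $R^x_{ey}\Rightarrow x=y$, $R^x_{ye}\Rightarrow x=y$. A relational interchange monoid $(X,R,S,\{e\})$: $R,S$ relationally associative with relational unit set $\{e\}$, satisfying for all $t,u,v,w,x$: $(\exists y,z.\ S^y_{tu}\wedge R^x_{yz}\wedge S^z_{vw})\Rightarrow(\exists y,z.\ R^y_{tv}\wedge S^x_{yz}\wedge R^z_{uw})$. Finitely decomposable: for each $x$ the sets $\{(y,z)\mid R^x_{yz}\}$ and $\{(y,z)\mid S^x_{yz}\}$ are finite. A grading of $(X,R,\{e\})$ is $|\cdot|:X\to\mathbb{N}$ with $|x|>0$ for $x\ne e$ and $|x|=|y|+|z|$ whenever $R^x_{yz}$. A Kleene algebra is a dioid (semiring with idempotent $+$, ordered by $a\le b\iff a+b=b$) with $^\star$ satisfying $1+a\bullet a^\star\le a^\star$, $c+a\bullet b\le b\Rightarrow a^\star\bullet c\le b$, $1+a^\star\bullet a\le a^\star$, $c+b\bullet a\le b\Rightarrow c\bullet a^\star\le b$. An interchange Kleene algebra is $(K,+,\bullet,\diamond,0,1,{}^{\star_\bullet},{}^{\star_\diamond})$ such that $(K,+,\bullet,0,1,{}^{\star_\bullet})$ and $(K,+,\diamond,0,1,{}^{\star_\diamond})$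 are Kleene algebras and $(a\diamond b)\bullet(c\diamond d)\le(a\bullet c)\diamond(b\bullet d)$ for all $a,b,c,d$. *)

theory Defs
  imports Main
begin

text \<open>A ternary relation is a curried predicate; \<open>R x y z\<close> stands for $R^x_{yz}$.\<close>

type_synonym 'x ternary = "'x \<Rightarrow> 'x \<Rightarrow> 'x \<Rightarrow> bool"

locale relational_monoid =
  fixes R :: "'x ternary" and e :: 'x
  assumes rel_assoc: "(\<exists>y. R y u v \<and> R x y w) \<longleftrightarrow> (\<exists>y. R x u y \<and> R y v w)"
    and rel_unit_left: "R x e x"
    and rel_unit_right: "R x x e"
    and rel_unit_left_eq: "R x e y \<Longrightarrow> x = y"
    and rel_unit_right_eq: "R x y e \<Longrightarrow> x = y"

locale relational_interchange_monoid =
  R: relational_monoid R e + S: relational_monoid S e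
  for R S :: "'x ternary" and e :: 'x +
  assumes rel_interchange:
    "(\<exists>y z. S y t u \<and> R x y z \<and> S z v w) \<Longrightarrow> (\<exists>y z. R y t v \<and> S x y z \<and> R z u w)"

definition finitely_decomposable :: "'x ternary \<Rightarrow> bool" where
  "finitely_decomposable R \<longleftrightarrow> (\<forall>x. finite {(y, z). R x y z})"

definition grading :: "'x ternary \<Rightarrow> 'x \<Rightarrow> ('x \<Rightarrow> nat) \<Rightarrow> bool" where
  "grading R e g \<longleftrightarrow> (\<forall>x. x \<noteq> e \<longrightarrow> 0 < g x) \<and> (\<forall>x y z. R x y z \<longrightarrow> g x = g y + g z)"

definition graded :: "'x ternary \<Rightarrow> 'x \<Rightarrow> bool" where
  "graded R e \<longleftrightarrow> (\<exists>g. grading R e g)"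

text \<open>The algebras take their operations as explicit parameters, because one type carries two
  multiplications and because the convolution algebra on functions has to be an instance.
  The case \<open>zero = one\<close> is not excluded.\<close>

locale dioid =
  add: comm_monoid add zero + mult: monoid mult one
  for add :: "'k \<Rightarrow> 'k \<Rightarrow> 'k" (infixl "\<oplus>" 65)
    and mult :: "'k \<Rightarrow> 'k \<Rightarrow> 'k" (infixl "\<odot>" 70)
    and zero :: 'k and one :: 'k +
  assumes distrib_left: "a \<odot> (b \<oplus> c) = a \<odot> b \<oplus> a \<odot> c"
    and distrib_right: "(a \<oplus> b) \<odot> c = a \<odot> c \<oplus> b \<odot> c"
    and zero_left: "zero \<odot> a = zero"
    and zero_right: "a \<odot> zero = zero"
    and add_idem: "a \<oplus> a = a"
begin

definition le :: "'k \<Rightarrow> 'k \<Rightarrow> bool" (infix "\<sqsubseteq>" 50) where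
  "a \<sqsubseteq> b \<longleftrightarrow> a \<oplus> b = b"

end

locale kleene_algebra = dioid +
  fixes star :: "'a \<Rightarrow> 'a"
  assumes star_unfold_left: "one \<oplus> a \<odot> star a \<sqsubseteq> star a"
    and star_induct_left: "c \<oplus> a \<odot> b \<sqsubseteq> b \<Longrightarrow> star a \<odot> c \<sqsubseteq> b"
    and star_unfold_right: "one \<oplus> star a \<odot> a \<sqsubseteq> star a"
    and star_induct_right: "c \<oplus> b \<odot> a \<sqsubseteq> b \<Longrightarrow> c \<odot> star a \<sqsubseteq> b"

locale interchange_kleene_algebra =
  seq: kleene_algebra add seq zero one star_seq +
  par: kleene_algebra add par zero one star_par
  for add :: "'k \<Rightarrow> 'k \<Rightarrow> 'k"
    and seq :: "'k \<Rightarrow> 'k \<Rightarrow> 'k" (infixl "\<bullet>" 70)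
    and par :: "'k \<Rightarrow> 'k \<Rightarrow> 'k" (infixl "\<diamondop>" 70)
    and zero one :: 'k
    and star_seq star_par :: "'k \<Rightarrow> 'k" +
  assumes interchange: "seq.le ((a \<diamondop> b) \<bullet> (c \<diamondop> d)) ((a \<bullet> c) \<diamondop> (b \<bullet> d))"

definition delta :: "'k \<Rightarrow> 'k \<Rightarrow> 'x \<Rightarrow> 'x \<Rightarrow> 'k" where
  "delta zero one e x = (if x = e then one else zero)"

text \<open>Sums are indexed by the decompositions \<open>(y, z)\<close> of \<open>x\<close>. As addition is idempotent, for finitely
  many decompositions this agrees with summing the set of values.\<close>

definition conv ::
  "('k \<Rightarrow> 'k \<Rightarrow> 'k) \<Rightarrow> 'k \<Rightarrow> ('k \<Rightarrow> 'k \<Rightarrow> 'k) \<Rightarrow> 'x ternary \<Rightarrow> ('x \<Rightarrow> 'k) \<Rightarrow> ('x \<Rightarrow> 'k) \<Rightarrow> 'x \<Rightarrow> 'k"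
  where
  "conv add zero mult R f g x =
     comm_monoid_set.F add zero (\<lambda>(y, z). mult (f y) (g z)) {(y, z). R x y z}"

text \<open>The defining equations of the star are recursive. The recursive calls for \<open>x\<close> are made at
  those \<open>z\<close> with $R^x_{yz}$ for some \<open>y \<noteq> e\<close>; a grading makes this relation well-founded, and the
  equations are then recovered in \<open>conv_star_unit\<close> and \<open>conv_star_nonunit\<close> below.\<close>

definition conv_star ::
  "('k \<Rightarrow> 'k \<Rightarrow> 'k) \<Rightarrow> 'k \<Rightarrow> ('k \<Rightarrow> 'k \<Rightarrow> 'k) \<Rightarrow> ('k \<Rightarrow> 'k) \<Rightarrow> 'x ternary \<Rightarrow> 'x \<Rightarrow>
    ('x \<Rightarrow> 'k) \<Rightarrow> 'x \<Rightarrow> 'k"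
  where
  "conv_star add zero mult star R e f =
     wfrec {(z, x). \<exists>y. y \<noteq> e \<and> R x y z}
       (\<lambda>h x. if x = e then star (f e)
              else mult (star (f e))
                     (comm_monoid_set.F add zero (\<lambda>(y, z). mult (f y) (h z))
                        {(y, z). R x y z \<and> y \<noteq> e}))"

lemma wf_decomposition:
  assumes "graded R e"
  shows "wf {(z, x). \<exists>y. y \<noteq> e \<and> R x y z}"
proof -
  obtain g where g: "grading R e g"
    using assms by (auto simp: graded_def)
  have "{(z, x). \<exists>y. y \<noteq> e \<and> R x y z} \<subseteq> measure g"
    using g by (fastforce simp: grading_def)
  then show ?thesis
    by (rule wf_subset[OF wf_measure])
qed

lemma conv_star_unit:
  assumes "graded R e"
  shows "conv_star add zero mult star R e f e = star (f e)"
  unfolding conv_star_def by (subst wfrec[OF wf_decomposition[OF assms]]) simp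

lemma conv_star_nonunit:
  assumes "graded R e" and "comm_monoid add zero" and "x \<noteq> e"
  shows "conv_star add zero mult star R e f x =
    mult (star (f e))
      (comm_monoid_set.F add zero (\<lambda>(y, z). mult (f y) (conv_star add zero mult star R e f z))
        {(y, z). R x y z \<and> y \<noteq> e})"
proof -
  interpret comm_monoid_set add zero
    using assms(2) by (simp add: comm_monoid_set_def)
  show ?thesis
    unfolding conv_star_def
    by (subst wfrec[OF wf_decomposition[OF assms(1)]])
       (use assms(3) in \<open>auto simp: cut_def intro!: arg_cong[where f = "mult (star (f e))"] cong\<close>)
qed

end

theory Submission
  imports Defs
begin

text \<open>
  A finite sum in a dioid is the least upper bound of its summands, so every inequality between
  convolutions reduces to inequalities between the summands indexed by single decompositions, and
  associativity and interchange transfer directly from the relations to the convolutions.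

  For the star put \<open>a = f e\<close>. If \<open>c + f * b \<le> b\<close>, then \<open>f\<^sup>\<star>(y) c(z) \<le> b(x)\<close> whenever $R^x_{yz}$, by
  well-founded induction on \<open>y\<close>: for \<open>y = e\<close> this is star induction for \<open>a\<close>, and otherwise a summand
  \<open>a\<^sup>\<star> f(u) f\<^sup>\<star>(v) c(z)\<close> is reassociated along $R^x_{uw}$, $R^w_{vz}$, so that the hypothesis for \<open>v\<close>
  yields \<open>a\<^sup>\<star> f(u) b(w) \<le> a\<^sup>\<star> b(x) \<le> b(x)\<close>. Right induction is dual, and the right unfold
  law follows from the left axioms.
\<close>

section \<open>Natural order and finite sums in a dioid\<close>

context dioid
begin

sublocale sum: comm_monoid_set add zero ..

lemma le_refl [simp]: "a \<sqsubseteq> a"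
  by (simp add: le_def add_idem)

lemma le_trans [trans]: "a \<sqsubseteq> b \<Longrightarrow> b \<sqsubseteq> c \<Longrightarrow> a \<sqsubseteq> c"
  unfolding le_def by (metis add.assoc)

lemma le_antisym: "a \<sqsubseteq> b \<Longrightarrow> b \<sqsubseteq> a \<Longrightarrow> a = b"
  unfolding le_def by (metis add.commute)

text \<open>An element is the least of its upper bounds, so comparing upper bounds settles equations
  between sums without reindexing them.\<close>

lemma eq_if_same_upper_bounds: "(\<And>c. a \<sqsubseteq> c \<longleftrightarrow> b \<sqsubseteq> c) \<Longrightarrow> a = b"
  using le_antisym le_refl by blast

lemma zero_le [simp]: "zero \<sqsubseteq> a"
  by (simp add: le_def)

lemma add_le_iff: "a \<oplus> b \<sqsubseteq> c \<longleftrightarrow> a \<sqsubseteq> c \<and> b \<sqsubseteq> c"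
  unfolding le_def by (metis add.assoc add.commute add_idem)

lemma mult_mono:
  assumes "a \<sqsubseteq> b" and "c \<sqsubseteq> d"
  shows "a \<odot> c \<sqsubseteq> b \<odot> d"
proof -
  have "a \<odot> c \<sqsubseteq> b \<odot> c"
    using assms(1) unfolding le_def by (metis distrib_right)
  also have "b \<odot> c \<sqsubseteq> b \<odot> d"
    using assms(2) unfolding le_def by (metis distrib_left)
  finally show ?thesis .
qed

lemma sum_le_iff: "finite A \<Longrightarrow> sum.F h A \<sqsubseteq> c \<longleftrightarrow> (\<forall>i\<in>A. h i \<sqsubseteq> c)"
  by (induction A rule: finite_induct) (auto simp: add_le_iff)

lemma le_sum: "finite A \<Longrightarrow> i \<in> A \<Longrightarrow> h i \<sqsubseteq> sum.F h A"
  using sum_le_iff le_refl by blast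

lemma mult_sum: "finite A \<Longrightarrow> a \<odot> sum.F h A = sum.F (\<lambda>i. a \<odot> h i) A"
  by (induction A rule: finite_induct) (auto simp: zero_right distrib_left)

lemma sum_mult: "finite A \<Longrightarrow> sum.F h A \<odot> a = sum.F (\<lambda>i. h i \<odot> a) A"
  by (induction A rule: finite_induct) (auto simp: zero_left distrib_right)

end

section \<open>Star inequalities for scalars\<close>

context kleene_algebra
begin

lemma one_le_star: "one \<sqsubseteq> star a"
  using star_unfold_left[of a] by (simp add: add_le_iff)

lemma mult_star_le: "a \<odot> star a \<sqsubseteq> star a"
  using star_unfold_left[of a] by (simp add: add_le_iff)

lemma star_mult_le: "a \<odot> b \<sqsubseteq> b \<Longrightarrow> star a \<odot> b \<sqsubseteq> b"
  by (rule star_induct_left) (simp add: add_le_iff)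

lemma mult_star_right_le: "b \<odot> a \<sqsubseteq> b \<Longrightarrow> b \<odot> star a \<sqsubseteq> b"
  by (rule star_induct_right) (simp add: add_le_iff)

end

section \<open>The dioid of functions under convolution\<close>

locale convolution_dioid =
  dioid add mult zero one + relational_monoid R e
  for add :: "'k \<Rightarrow> 'k \<Rightarrow> 'k" (infixl "\<oplus>" 65)
    and mult :: "'k \<Rightarrow> 'k \<Rightarrow> 'k" (infixl "\<odot>" 70)
    and zero one :: 'k
    and R :: "'x ternary" and e :: 'x +
  assumes finitely_decomposable: "finitely_decomposable R"
begin

abbreviation convolution :: "('x \<Rightarrow> 'k) \<Rightarrow> ('x \<Rightarrow> 'k) \<Rightarrow> 'x \<Rightarrow> 'k" (infixl "\<otimes>" 70) where
  "f \<otimes> g \<equiv> conv add zero mult R f g"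

lemma finite_decompositions [simp]: "finite {(y, z). R x y z}"
  using finitely_decomposable by (simp add: finitely_decomposable_def)

lemma conv_le_iff: "(f \<otimes> g) x \<sqsubseteq> c \<longleftrightarrow> (\<forall>y z. R x y z \<longrightarrow> f y \<odot> g z \<sqsubseteq> c)"
  by (auto simp: conv_def sum_le_iff)

lemma mult_conv_le_iff: "a \<odot> (f \<otimes> g) x \<sqsubseteq> c \<longleftrightarrow> (\<forall>y z. R x y z \<longrightarrow> a \<odot> (f y \<odot> g z) \<sqsubseteq> c)"
  by (auto simp: conv_def mult_sum sum_le_iff)

lemma conv_mult_le_iff: "(f \<otimes> g) x \<odot> a \<sqsubseteq> c \<longleftrightarrow> (\<forall>y z. R x y z \<longrightarrow> f y \<odot> g z \<odot> a \<sqsubseteq> c)"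
  by (auto simp: conv_def sum_mult sum_le_iff)

lemma mult_le_conv: "R x y z \<Longrightarrow> f y \<odot> g z \<sqsubseteq> (f \<otimes> g) x"
  using conv_le_iff le_refl by blast

lemma conv_assoc: "f \<otimes> g \<otimes> h = f \<otimes> (g \<otimes> h)"
proof (rule ext, rule eq_if_same_upper_bounds)
  fix x c
  have "(f \<otimes> g \<otimes> h) x \<sqsubseteq> c \<longleftrightarrow>
      (\<forall>u v w. (\<exists>y. R y u v \<and> R x y w) \<longrightarrow> f u \<odot> g v \<odot> h w \<sqsubseteq> c)"
    by (auto simp: conv_le_iff conv_mult_le_iff)
  also have "\<dots> \<longleftrightarrow> (f \<otimes> (g \<otimes> h)) x \<sqsubseteq> c"
    unfolding rel_assoc by (auto simp: conv_le_iff mult_conv_le_iff mult.assoc)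
  finally show "(f \<otimes> g \<otimes> h) x \<sqsubseteq> c \<longleftrightarrow> (f \<otimes> (g \<otimes> h)) x \<sqsubseteq> c" .
qed

text \<open>Decompositions with a left factor other than \<open>e\<close> contribute
  \<open>zero\<close>. A left factor \<open>e\<close> forces the right factor to be
  \<open>x\<close>, and \<open>R x e x\<close> does occur.\<close>

lemma delta_conv: "delta zero one e \<otimes> f = f"
proof (rule ext, rule eq_if_same_upper_bounds)
  show "(delta zero one e \<otimes> f) x \<sqsubseteq> c \<longleftrightarrow> f x \<sqsubseteq> c" for x c
    using rel_unit_left[of x] by (auto simp: conv_le_iff delta_def zero_left dest: rel_unit_left_eq)
qed

lemma conv_delta: "f \<otimes> delta zero one e = f"
proof (rule ext, rule eq_if_same_upper_bounds)
  show "(f \<otimes> delta zero one e) x \<sqsubseteq> c \<longleftrightarrow> f x \<sqsubseteq> c" for x c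
    using rel_unit_right[of x] by (auto simp: conv_le_iff delta_def zero_right dest: rel_unit_right_eq)
qed

sublocale conv: dioid "\<lambda>f g x. f x \<oplus> g x" "conv add zero mult R" "\<lambda>x. zero" "delta zero one e"
proof
  fix f g h :: "'x \<Rightarrow> 'k"
  show "f \<otimes> (\<lambda>x. g x \<oplus> h x) = (\<lambda>x. (f \<otimes> g) x \<oplus> (f \<otimes> h) x)"
    by (rule ext, rule eq_if_same_upper_bounds)
      (auto simp: conv_le_iff distrib_left add_le_iff)
  show "(\<lambda>x. f x \<oplus> g x) \<otimes> h = (\<lambda>x. (f \<otimes> h) x \<oplus> (g \<otimes> h) x)"
    by (rule ext, rule eq_if_same_upper_bounds)
      (auto simp: conv_le_iff distrib_right add_le_iff)
  show "(\<lambda>x. zero) \<otimes> f = (\<lambda>x. zero)"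
    by (rule ext, rule eq_if_same_upper_bounds) (auto simp: conv_le_iff zero_left)
  show "f \<otimes> (\<lambda>x. zero) = (\<lambda>x. zero)"
    by (rule ext, rule eq_if_same_upper_bounds) (auto simp: conv_le_iff zero_right)
qed (auto simp: conv_assoc delta_conv conv_delta add_idem add.assoc add.left_commute
    intro: add.commute)

lemma conv_le_fun_iff: "conv.le f g \<longleftrightarrow> (\<forall>x. f x \<sqsubseteq> g x)"
  by (auto simp: conv.le_def le_def fun_eq_iff)

end

section \<open>The star of the convolution algebra\<close>

locale convolution_kleene_algebra =
  kleene_algebra add mult zero one star + convolution_dioid add mult zero one R e
  for add :: "'k \<Rightarrow> 'k \<Rightarrow> 'k" (infixl "\<oplus>" 65)
    and mult :: "'k \<Rightarrow> 'k \<Rightarrow> 'k" (infixl "\<odot>" 70)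
    and zero one :: 'k and star :: "'k \<Rightarrow> 'k"
    and R :: "'x ternary" and e :: 'x +
  assumes graded: "graded R e"
begin

abbreviation cstar :: "('x \<Rightarrow> 'k) \<Rightarrow> 'x \<Rightarrow> 'k" where
  "cstar \<equiv> conv_star add zero mult star R e"

text \<open>For a grading \<open>g\<close>, \<open>R e e e\<close> gives
  \<open>g e = g e + g e\<close>, hence \<open>g e = 0\<close>. Then \<open>g y + g z = 0\<close>,
  and positivity away from \<open>e\<close> leaves only \<open>e\<close>.\<close>

lemma unit_decomposition: "R e y z \<Longrightarrow> y = e \<and> z = e"
  using graded rel_unit_left[of e] unfolding graded_def grading_def
  by (metis add_is_0 add_cancel_left_left less_numeral_extra(3))

lemma decomposition_induct [case_names less]:
  assumes "\<And>x. (\<And>y z. R x y z \<Longrightarrow> y \<noteq> e \<Longrightarrow> P z) \<Longrightarrow> P x"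
  shows "P x"
  using wf_decomposition[OF graded] by (induction x rule: wf_induct_rule) (auto intro: assms)

lemma finite_nonunit_decompositions [simp]: "finite {(y, z). R x y z \<and> y \<noteq> e}"
  by (rule finite_subset[OF _ finite_decompositions[of x]]) auto

lemma cstar_unit: "cstar f e = star (f e)"
  using graded by (rule conv_star_unit)

lemma cstar_nonunit:
  "x \<noteq> e \<Longrightarrow> cstar f x = star (f e) \<odot> sum.F (\<lambda>(y, z). f y \<odot> cstar f z) {(y, z). R x y z \<and> y \<noteq> e}"
  using graded add.comm_monoid_axioms by (rule conv_star_nonunit)

text \<open>Products are bracketed to the right here and to the left in the dual, matching the side
  from which each star induction absorbs factors.\<close>

lemma cstar_mult_le_iff:
  assumes "x \<noteq> e"
  shows "cstar f x \<odot> a \<sqsubseteq> c \<longleftrightarrow>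
    (\<forall>y z. R x y z \<longrightarrow> y \<noteq> e \<longrightarrow> star (f e) \<odot> (f y \<odot> (cstar f z \<odot> a)) \<sqsubseteq> c)"
  by (auto simp: cstar_nonunit[OF assms] mult_sum sum_mult sum_le_iff mult.assoc)

lemma mult_cstar_le_iff:
  assumes "x \<noteq> e"
  shows "a \<odot> cstar f x \<sqsubseteq> c \<longleftrightarrow>
    (\<forall>y z. R x y z \<longrightarrow> y \<noteq> e \<longrightarrow> a \<odot> star (f e) \<odot> f y \<odot> cstar f z \<sqsubseteq> c)"
  by (auto simp: cstar_nonunit[OF assms] mult_sum sum_mult sum_le_iff mult.assoc)

lemma delta_le_cstar: "delta zero one e x \<sqsubseteq> cstar f x"
  by (simp add: delta_def cstar_unit one_le_star)

lemma mult_cstar_le: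
  assumes "R x y z"
  shows "f y \<odot> cstar f z \<sqsubseteq> cstar f x"
proof (cases "x = e")
  case True
  then show ?thesis
    using assms unit_decomposition[of y z] by (auto simp: cstar_unit mult_star_le)
next
  case x: False
  let ?\<Sigma> = "sum.F (\<lambda>(y, z). f y \<odot> cstar f z) {(y, z). R x y z \<and> y \<noteq> e}"
  show ?thesis
  proof (cases "y = e")
    \<comment> \<open>This decomposition is excluded from the recursive sum, so the extra factor
      \<open>f e\<close> is absorbed by the leading \<open>star (f e)\<close> instead.\<close>
    case True
    then have "z = x"
      using assms rel_unit_left_eq by auto
    moreover have "f e \<odot> star (f e) \<odot> ?\<Sigma> \<sqsubseteq> star (f e) \<odot> ?\<Sigma>"
      by (intro mult_mono mult_star_le le_refl)
    ultimately show ?thesis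
      using True x by (simp add: cstar_nonunit mult.assoc)
  next
    case False
    then have "f y \<odot> cstar f z \<sqsubseteq> ?\<Sigma>"
      using assms le_sum[of "{(y, z). R x y z \<and> y \<noteq> e}" "(y, z)" "\<lambda>(y, z). f y \<odot> cstar f z"]
      by simp
    then have "one \<odot> (f y \<odot> cstar f z) \<sqsubseteq> star (f e) \<odot> ?\<Sigma>"
      by (intro mult_mono one_le_star)
    then show ?thesis
      using x by (simp add: cstar_nonunit)
  qed
qed

lemma cstar_mult_induct:
  assumes c: "\<And>x. c x \<sqsubseteq> b x" and b: "\<And>x y z. R x y z \<Longrightarrow> f y \<odot> b z \<sqsubseteq> b x"
    and "R x y z"
  shows "cstar f y \<odot> c z \<sqsubseteq> b x"
  using \<open>R x y z\<close>
proof (induction y arbitrary: x z rule: decomposition_induct)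
  case (less y)
  \<comment> \<open>The decomposition \<open>R x e x\<close> turns \<open>b\<close> into a scalar
    inequality for \<open>f e\<close>, to which scalar star induction applies.\<close>
  have star_b: "star (f e) \<odot> b x \<sqsubseteq> b x"
    by (intro star_mult_le b rel_unit_left)
  show ?case
  proof (cases "y = e")
    case True
    then have "x = z"
      using less.prems rel_unit_left_eq by auto
    then have "star (f e) \<odot> c z \<sqsubseteq> star (f e) \<odot> b x"
      by (intro mult_mono le_refl) (simp add: c)
    with star_b show ?thesis
      using True le_trans by (simp add: cstar_unit)
  next
    case False
    have "star (f e) \<odot> (f u \<odot> (cstar f v \<odot> c z)) \<sqsubseteq> b x" if uv: "R y u v" "u \<noteq> e" for u v
    proof -
      obtain w where w: "R x u w" "R w v z"
        using uv less.prems rel_assoc by blast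
      have "f u \<odot> (cstar f v \<odot> c z) \<sqsubseteq> f u \<odot> b w"
        using less.IH uv w by (intro mult_mono le_refl) blast
      also have "\<dots> \<sqsubseteq> b x"
        using b w by blast
      finally have "star (f e) \<odot> (f u \<odot> (cstar f v \<odot> c z)) \<sqsubseteq> star (f e) \<odot> b x"
        by (intro mult_mono le_refl)
      also note star_b
      finally show ?thesis .
    qed
    then show ?thesis
      using False by (simp add: cstar_mult_le_iff)
  qed
qed

text \<open>As \<open>cstar\<close> unfolds on the left, \<open>b y\<close> first absorbs
  \<open>star (f e)\<close> along \<open>R y y e\<close> and then \<open>f u\<close>, becoming
  \<open>b w\<close>. The left factor thus changes, which is why \<open>y\<close> stays arbitrary in
  the induction on \<open>z\<close>.\<close>

lemma mult_cstar_induct: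
  assumes b: "\<And>x y z. R x y z \<Longrightarrow> b y \<odot> f z \<sqsubseteq> b x" and "R x y z"
  shows "b y \<odot> cstar f z \<sqsubseteq> b x"
  using \<open>R x y z\<close>
proof (induction z arbitrary: x y rule: decomposition_induct)
  case (less z)
  have b_star: "b y \<odot> star (f e) \<sqsubseteq> b y"
    by (intro mult_star_right_le b rel_unit_right)
  show ?case
  proof (cases "z = e")
    case True
    then show ?thesis
      using less.prems rel_unit_right_eq b_star by (auto simp: cstar_unit)
  next
    case False
    have "b y \<odot> star (f e) \<odot> f u \<odot> cstar f v \<sqsubseteq> b x" if uv: "R z u v" "u \<noteq> e" for u v
    proof -
      obtain w where w: "R w y u" "R x w v"
        using uv less.prems rel_assoc by blast
      have "b y \<odot> star (f e) \<odot> f u \<sqsubseteq> b y \<odot> f u"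
        by (intro mult_mono b_star le_refl)
      also have "\<dots> \<sqsubseteq> b w"
        using b w by blast
      finally have "b y \<odot> star (f e) \<odot> f u \<odot> cstar f v \<sqsubseteq> b w \<odot> cstar f v"
        by (intro mult_mono le_refl)
      also have "\<dots> \<sqsubseteq> b x"
        using less.IH uv w by blast
      finally show ?thesis .
    qed
    then show ?thesis
      using False by (simp add: mult_cstar_le_iff)
  qed
qed

sublocale conv: kleene_algebra "\<lambda>f g x. f x \<oplus> g x" "conv add zero mult R" "\<lambda>x. zero"
  "delta zero one e" cstar
proof
  fix f b c :: "'x \<Rightarrow> 'k"
  show "conv.le (\<lambda>x. delta zero one e x \<oplus> (f \<otimes> cstar f) x) (cstar f)"
    by (simp add: conv_le_fun_iff add_le_iff conv_le_iff delta_le_cstar mult_cstar_le)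
  show "conv.le (cstar f \<otimes> c) b" if "conv.le (\<lambda>x. c x \<oplus> (f \<otimes> b) x) b"
    using that cstar_mult_induct[of c b f]
    by (auto simp: conv_le_fun_iff add_le_iff conv_le_iff)
  \<comment> \<open>This makes \<open>c = f\<close> and \<open>b = cstar f\<close> admissible in the
    left induction, which then yields the right unfold law.\<close>
  have "f x \<sqsubseteq> cstar f x" for x
  proof -
    have "f x \<odot> one \<sqsubseteq> f x \<odot> cstar f e"
      by (intro mult_mono le_refl) (simp add: cstar_unit one_le_star)
    also have "\<dots> \<sqsubseteq> cstar f x"
      by (intro mult_cstar_le rel_unit_right)
    finally show ?thesis
      by simp
  qed
  then show "conv.le (\<lambda>x. delta zero one e x \<oplus> (cstar f \<otimes> f) x) (cstar f)"
    using cstar_mult_induct[of f "cstar f" f] mult_cstar_le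
    by (simp add: conv_le_fun_iff add_le_iff conv_le_iff delta_le_cstar)
  show "conv.le (c \<otimes> cstar f) b" if "conv.le (\<lambda>x. c x \<oplus> (b \<otimes> f) x) b"
  proof -
    have c: "c x \<sqsubseteq> b x" and b: "R x y z \<Longrightarrow> b y \<odot> f z \<sqsubseteq> b x" for x y z
      using that by (auto simp: conv_le_fun_iff add_le_iff conv_le_iff)
    have "c y \<odot> cstar f z \<sqsubseteq> b x" if "R x y z" for x y z
      \<comment> \<open>The right induction lemma starts from \<open>b\<close> itself; the
        inequality \<open>c \<sqsubseteq> b\<close> is put in front by monotonicity.\<close>
      using mult_mono[OF c le_refl] mult_cstar_induct[OF b that] by (rule le_trans)
    then show ?thesis
      by (simp add: conv_le_fun_iff conv_le_iff)
  qed
qed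

end

theorem theorem7p6:
  fixes R S :: "'x ternary" and e :: 'x
    and add seq par :: "'k \<Rightarrow> 'k \<Rightarrow> 'k" and zero one :: 'k and star_seq star_par :: "'k \<Rightarrow> 'k"
  assumes "relational_interchange_monoid R S e"
    and "finitely_decomposable R" and "finitely_decomposable S"
    and "graded R e" and "graded S e"
    and "interchange_kleene_algebra add seq par zero one star_seq star_par"
  shows "interchange_kleene_algebra
    (\<lambda>f g x. add (f x) (g x))
    (conv add zero seq R)
    (conv add zero par S)
    (\<lambda>x. zero)
    (delta zero one e)
    (conv_star add zero seq star_seq R e)
    (conv_star add zero par star_par S e)"
proof -
  interpret rel: relational_interchange_monoid R S e
    by fact
  interpret K: interchange_kleene_algebra add seq par zero one star_seq star_par
    by fact
  interpret seq: convolution_kleene_algebra add seq zero one star_seq R e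
    using assms by unfold_locales
  interpret par: convolution_kleene_algebra add par zero one star_par S e
    using assms by unfold_locales
  show ?thesis
  proof
    fix f g h k :: "'x \<Rightarrow> 'k"
    have "K.seq.le (seq (par (f t) (g u)) (par (h v) (k w)))
        (conv add zero par S (conv add zero seq R f h) (conv add zero seq R g k) x)"
      if "R x y z" "S y t u" "S z v w" for x y z t u v w
    proof -
      obtain y' z' where *: "R y' t v" "S x y' z'" "R z' u w"
        using rel.rel_interchange \<open>R x y z\<close> \<open>S y t u\<close> \<open>S z v w\<close> by metis
      note K.interchange
      also have "K.seq.le (par (seq (f t) (h v)) (seq (g u) (k w)))
          (par (conv add zero seq R f h y') (conv add zero seq R g k z'))"
        using * by (intro K.par.mult_mono seq.mult_le_conv)
      also have "K.seq.le \<dots>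
          (conv add zero par S (conv add zero seq R f h) (conv add zero seq R g k) x)"
        using * by (intro par.mult_le_conv)
      finally show ?thesis .
    qed
    then have "K.seq.le (seq (conv add zero par S f g y) (conv add zero par S h k z))
        (conv add zero par S (conv add zero seq R f h) (conv add zero seq R g k) x)"
      if "R x y z" for x y z
      using that by (simp add: conv_def[of add zero par S f g] conv_def[of add zero par S h k]
          K.seq.mult_sum K.seq.sum_mult K.seq.sum_le_iff split_beta)
    then show "seq.conv.le
        (conv add zero seq R (conv add zero par S f g) (conv add zero par S h k))
        (conv add zero par S (conv add zero seq R f h) (conv add zero seq R g k))"
      by (simp add: seq.conv_le_fun_iff seq.conv_le_iff)
  qed
qed

end
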